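(* Let $G$ be a po-group, $I$ a set, and $\lambda,\rho:I\to I$ bijections. Then there is a bijection $\phi:I\to I$ such that the kite pseudo effect algebra $K_I^{\lambda,\rho}(G)$ is isomorphic, as a pseudo effect algebra, to $\Gamma(\mathbb Z\ltimes_\phi G,u)$, where $u=(1,e^I)$.
   Context: Po-groups (partially ordered groups, not necessarily Abelian) are written multiplicatively with identity $e$; $G^+=\{g\in G: g\ge e\}$, $G^-=\{g\in G:g\le e\}$. A pseudo effect algebra is a partial algebra $(E;+,0,1)$ with a partial binary operation $+$ and constants $0,1$ such that for all $a,b,c\in E$: (i) $a+b$ and $(a+b)+c$ exist iff $b+c$ and $a+(b+c)$ exist, and then they are equal; (ii) there are exactly one $d$ and exactly one $f$ in $E$ with $a+d=f+a=1$; (iii) if $a+b$ exists, there are $d,f\in E$ with $a+b=d+a=b+f$; (iv) if $1+a$ or $a+1$ exists then $a=0$. A homomorphism $h:E\to F$ of pseudo effect algebras satisfies $h(1)=1$ and: if $a+b$ is defined then $h(a)+h(b)$ is defined and equals $h(a+b)$. An isomorphism is a bijective homomorphism whose inverse is a homomorphism. For a po-group $H$ and $u\in H^+$, $\Gamma(H,u)=\{h\in H: e_H\le h\le u\}$ is the pseudo effect algebra with zero $e_H$ (the identity of $H$), unit $u$, and partial sum equal to the group product whenever that product lies in $\Gamma(H,u)$. The kite $K_I^{\lambda,\rho}(G)$: its universe is the disjoint union of $(G^+)^I$ (lower part, elements written $\langle f_i\rangle$, $f_i\ge e$) and $(G^-)^I$ (upper part, elements written $\langle a_i^{-1}\rangle$,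 $a_i\ge e$); the constant sequence $e$ in the lower part is $0$, the constant sequence $e$ in the upper part is $1$, and these are considered distinct. The partial sum is: the sum of two upper elements is undefined; $\langle a_i^{-1}\rangle+\langle f_i\rangle=\langle a_i^{-1}f_{\rho^{-1}(i)}\rangle$ (upper part), defined iff $f_{\rho^{-1}(i)}\le a_i$ for all $i\in I$; $\langle f_i\rangle+\langle a_i^{-1}\rangle=\langle f_{\lambda^{-1}(i)}a_i^{-1}\rangle$ (upper part), defined iff $f_{\lambda^{-1}(i)}\le a_i$ for all $i\in I$; $\langle f_i\rangle+\langle g_i\rangle=\langle f_ig_i\rangle$ (lower part), always defined. This is a pseudo effect algebra. For a bijection $\phi:I\to I$, $\mathbb Z\ltimes_\phi G$ is the po-group with underlying set $\mathbb Z\times G^I$, multiplication $(n,\langle x_i\rangle)*_\phi(m,\langle y_i\rangle)=(n+m,\langle x_iy_{\phi^n(i)}\rangle)$, identity $(0,e^I)$ ($e^I$ the constant sequence $e$), and order $(n,\langle x_i\rangle)\le(m,\langle y_i\rangle)$ iff $n<m$, or $n=m$ and $x_i\le y_i$ for all $i\in I$. *)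

theory Defs
  imports "HOL-Algebra.Bij"
begin

section \<open>Po-groups\<close>

record 'a po_monoid = "'a monoid" +
  po_le :: "'a \<Rightarrow> 'a \<Rightarrow> bool"  (infixl \<open>\<preceq>\<index>\<close> 50)

locale po_group = group G for G :: "('a, 'm) po_monoid_scheme" (structure) +
  assumes po_refl: "x \<in> carrier G \<Longrightarrow> x \<preceq> x"
    and po_antisym: "\<lbrakk>x \<in> carrier G; y \<in> carrier G; x \<preceq> y; y \<preceq> x\<rbrakk> \<Longrightarrow> x = y"
    and po_trans: "\<lbrakk>x \<in> carrier G; y \<in> carrier G; z \<in> carrier G; x \<preceq> y; y \<preceq> z\<rbrakk> \<Longrightarrow> x \<preceq> z"
    and po_mult_left: "\<lbrakk>x \<in> carrier G; y \<in> carrier G; z \<in> carrier G; x \<preceq> y\<rbrakk> \<Longrightarrow> z \<otimes> x \<preceq> z \<otimes> y"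
    and po_mult_right: "\<lbrakk>x \<in> carrier G; y \<in> carrier G; z \<in> carrier G; x \<preceq> y\<rbrakk> \<Longrightarrow> x \<otimes> z \<preceq> y \<otimes> z"

definition pos_cone :: "('a, 'm) po_monoid_scheme \<Rightarrow> 'a set" where
  "pos_cone G = {g \<in> carrier G. \<one>\<^bsub>G\<^esub> \<preceq>\<^bsub>G\<^esub> g}"

definition neg_cone :: "('a, 'm) po_monoid_scheme \<Rightarrow> 'a set" where
  "neg_cone G = {g \<in> carrier G. g \<preceq>\<^bsub>G\<^esub> \<one>\<^bsub>G\<^esub>}"


section \<open>Pseudo effect algebras\<close>

text \<open>The value \<open>None\<close> of \<open>psum\<close> means that the sum is undefined. Values of \<open>psum\<close> at
  arguments outside the carrier are irrelevant.\<close>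

record 'a partial_algebra = "'a partial_object" +
  psum :: "'a \<Rightarrow> 'a \<Rightarrow> 'a option"
  pzero :: 'a
  punit :: 'a

text \<open>An equation between two strict (\<open>Option.bind\<close>) compositions asserts both that one side
  is defined iff the other one is and that the values then agree.\<close>

locale pseudo_effect_algebra =
  fixes E :: "('a, 'm) partial_algebra_scheme"
  assumes psum_closed:
      "\<lbrakk>a \<in> carrier E; b \<in> carrier E; psum E a b = Some s\<rbrakk> \<Longrightarrow> s \<in> carrier E"
    and pzero_closed: "pzero E \<in> carrier E"
    and punit_closed: "punit E \<in> carrier E"
    and psum_assoc:
      "\<lbrakk>a \<in> carrier E; b \<in> carrier E; c \<in> carrier E\<rbrakk> \<Longrightarrow>
        Option.bind (psum E a b) (\<lambda>s. psum E s c) = Option.bind (psum E b c) (\<lambda>t. psum E a t)"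
    and right_complement:
      "a \<in> carrier E \<Longrightarrow> \<exists>!d. d \<in> carrier E \<and> psum E a d = Some (punit E)"
    and left_complement:
      "a \<in> carrier E \<Longrightarrow> \<exists>!f. f \<in> carrier E \<and> psum E f a = Some (punit E)"
    and psum_conjugate:
      "\<lbrakk>a \<in> carrier E; b \<in> carrier E; psum E a b = Some s\<rbrakk> \<Longrightarrow>
        \<exists>d\<in>carrier E. \<exists>f\<in>carrier E. psum E d a = Some s \<and> psum E b f = Some s"
    and psum_punit:
      "\<lbrakk>a \<in> carrier E; psum E (punit E) a \<noteq> None \<or> psum E a (punit E) \<noteq> None\<rbrakk> \<Longrightarrow> a = pzero E"

definition pea_hom ::
  "('a, 'm) partial_algebra_scheme \<Rightarrow> ('b, 'n) partial_algebra_scheme \<Rightarrow> ('a \<Rightarrow> 'b) set" where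
  "pea_hom E F = {h. h \<in> carrier E \<rightarrow> carrier F \<and> h (punit E) = punit F \<and>
     (\<forall>a\<in>carrier E. \<forall>b\<in>carrier E. \<forall>s. psum E a b = Some s \<longrightarrow> psum F (h a) (h b) = Some (h s))}"

definition pea_iso ::
  "('a, 'm) partial_algebra_scheme \<Rightarrow> ('b, 'n) partial_algebra_scheme \<Rightarrow> ('a \<Rightarrow> 'b) set" where
  "pea_iso E F = {h. bij_betw h (carrier E) (carrier F) \<and> h \<in> pea_hom E F \<and>
     inv_into (carrier E) h \<in> pea_hom F E}"

definition pea_isomorphic ::
  "('a, 'm) partial_algebra_scheme \<Rightarrow> ('b, 'n) partial_algebra_scheme \<Rightarrow> bool" where
  "pea_isomorphic E F \<longleftrightarrow>
     pseudo_effect_algebra E \<and> pseudo_effect_algebra F \<and> pea_iso E F \<noteq> {}"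


section \<open>Intervals in po-groups\<close>

definition Gamma :: "('a, 'm) po_monoid_scheme \<Rightarrow> 'a \<Rightarrow> 'a partial_algebra" where
  "Gamma H u =
    \<lparr>carrier = {h \<in> carrier H. \<one>\<^bsub>H\<^esub> \<preceq>\<^bsub>H\<^esub> h \<and> h \<preceq>\<^bsub>H\<^esub> u},
     psum = (\<lambda>x y. if x \<otimes>\<^bsub>H\<^esub> y \<in> {h \<in> carrier H. \<one>\<^bsub>H\<^esub> \<preceq>\<^bsub>H\<^esub> h \<and> h \<preceq>\<^bsub>H\<^esub> u}
                   then Some (x \<otimes>\<^bsub>H\<^esub> y) else None),
     pzero = \<one>\<^bsub>H\<^esub>,
     punit = u\<rparr>"

lemma (in po_group) pseudo_effect_algebra_Gamma:
  assumes u: "u \<in> pos_cone G"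
  shows "pseudo_effect_algebra (Gamma G u)"
proof -
  define C where "C = {h \<in> carrier G. \<one> \<preceq> h \<and> h \<preceq> u}"
  have uG: "u \<in> carrier G" and u1: "\<one> \<preceq> u"
    using u by (auto simp: pos_cone_def)
  have CG: "x \<in> carrier G" "\<one> \<preceq> x" "x \<preceq> u" if "x \<in> C" for x
    using that by (auto simp: C_def)
  have car: "carrier (Gamma G u) = C"
    and ps: "psum (Gamma G u) x y = (if x \<otimes> y \<in> C then Some (x \<otimes> y) else None)"
    and z: "pzero (Gamma G u) = \<one>" and un: "punit (Gamma G u) = u" for x y
    by (auto simp: Gamma_def C_def)
  have le_mr: "x \<preceq> x \<otimes> y" if "x \<in> carrier G" "y \<in> carrier G" "\<one> \<preceq> y" for x y
    using po_mult_left[of \<one> y x] that by simp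
  have le_ml: "x \<preceq> y \<otimes> x" if "x \<in> carrier G" "y \<in> carrier G" "\<one> \<preceq> y" for x y
    using po_mult_right[of \<one> y x] that by simp
  have inv_le: "inv y \<preceq> \<one>" if "y \<in> carrier G" "\<one> \<preceq> y" for y
    using po_mult_left[of \<one> y "inv y"] that by simp
  have mr_le: "x \<otimes> inv y \<preceq> x" if "x \<in> carrier G" "y \<in> carrier G" "\<one> \<preceq> y" for x y
    using po_mult_left[of "inv y" \<one> x] inv_le[of y] that by simp
  have ml_le: "inv y \<otimes> x \<preceq> x" if "x \<in> carrier G" "y \<in> carrier G" "\<one> \<preceq> y" for x y
    using po_mult_right[of "inv y" \<one> x] inv_le[of y] that by simp
  have uC: "u \<in> C" using uG u1 by (simp add: C_def po_refl)
  have oC: "\<one> \<in> C" using u1 by (simp add: C_def po_refl)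
  have in_C: "x \<in> C" if "x \<in> carrier G" "\<one> \<preceq> x" "x \<preceq> s" "s \<in> C" for x s
    using that po_trans[of x s u] uG by (auto simp: C_def)
  show ?thesis
  proof (unfold_locales, unfold car z un)
    show "s \<in> C" if "psum (Gamma G u) a b = Some s" for a b s
      using that by (auto simp: ps split: if_splits)
    show "\<one> \<in> C" "u \<in> C" by fact+
  next
    fix a b c assume a: "a \<in> C" and b: "b \<in> C" and c: "c \<in> C"
    note [simp] = CG(1)[OF a] CG(1)[OF b] CG(1)[OF c]
    have 1: "\<one> \<preceq> x \<otimes> y" if "x \<in> C" "y \<in> C" for x y
      using le_mr[of x y] po_trans[of \<one> x "x \<otimes> y"] CG that by auto
    have "b \<otimes> c \<in> C" if "a \<otimes> b \<otimes> c \<in> C"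
      using in_C[of "b \<otimes> c" "a \<otimes> b \<otimes> c"] le_ml[of "b \<otimes> c" a] 1[OF b c] CG(2)[OF a] that
      by (simp add: m_assoc)
    moreover have "a \<otimes> b \<in> C" if "a \<otimes> b \<otimes> c \<in> C"
      using in_C[of "a \<otimes> b" "a \<otimes> b \<otimes> c"] le_mr[of "a \<otimes> b" c] 1[OF a b] CG(2)[OF c] that
      by simp
    moreover have "a \<otimes> b \<otimes> c = a \<otimes> (b \<otimes> c)" by (simp add: m_assoc)
    ultimately show "Option.bind (psum (Gamma G u) a b) (\<lambda>s. psum (Gamma G u) s c) =
        Option.bind (psum (Gamma G u) b c) (psum (Gamma G u) a)"
      by (auto simp: ps)
  next
    fix a assume a: "a \<in> C"
    note [simp] = CG(1)[OF a] uG
    have r: "inv a \<otimes> u \<in> C"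
      using in_C[of "inv a \<otimes> u" u] ml_le[of u a] po_mult_left[of a u "inv a"] CG[OF a] uC by simp
    show "\<exists>!d. d \<in> C \<and> psum (Gamma G u) a d = Some u"
    proof (rule ex1I[of _ "inv a \<otimes> u"])
      show "inv a \<otimes> u \<in> C \<and> psum (Gamma G u) a (inv a \<otimes> u) = Some u"
        using r uC by (simp add: ps m_assoc[symmetric])
    next
      fix d assume d: "d \<in> C \<and> psum (Gamma G u) a d = Some u"
      then have "a \<otimes> d = u" by (auto simp: ps split: if_splits)
      then show "d = inv a \<otimes> u" using CG(1)[of d] d by (auto simp: m_assoc[symmetric])
    qed
    have l: "u \<otimes> inv a \<in> C"
      using in_C[of "u \<otimes> inv a" u] mr_le[of u a] po_mult_right[of a u "inv a"] CG[OF a] uC by simp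
    show "\<exists>!d. d \<in> C \<and> psum (Gamma G u) d a = Some u"
    proof (rule ex1I[of _ "u \<otimes> inv a"])
      show "u \<otimes> inv a \<in> C \<and> psum (Gamma G u) (u \<otimes> inv a) a = Some u"
        using l uC by (simp add: ps m_assoc)
    next
      fix d assume d: "d \<in> C \<and> psum (Gamma G u) d a = Some u"
      then have "d \<otimes> a = u" by (auto simp: ps split: if_splits)
      then show "d = u \<otimes> inv a" using CG(1)[of d] d by (auto simp: m_assoc)
    qed
  next
    fix a b s assume a: "a \<in> C" and b: "b \<in> C" and "psum (Gamma G u) a b = Some s"
    then have s: "s = a \<otimes> b" "s \<in> C" by (auto simp: ps split: if_splits)
    note [simp] = CG(1)[OF a] CG(1)[OF b]
    have d: "s \<otimes> inv a \<in> C"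
      using in_C[of "s \<otimes> inv a" s] s mr_le[of s a] CG[OF a] CG[OF b]
        po_mult_right[of a s "inv a"] le_mr[of a b] by simp
    have f: "inv b \<otimes> s \<in> C"
      using in_C[of "inv b \<otimes> s" s] s ml_le[of s b] CG[OF a] CG[OF b]
        po_mult_left[of b s "inv b"] le_ml[of b a] by simp
    have "psum (Gamma G u) (s \<otimes> inv a) a = Some s" "psum (Gamma G u) b (inv b \<otimes> s) = Some s"
      using CG(1)[OF s(2)] s(2) m_assoc[of s "inv a" a] m_assoc[of b "inv b" s, symmetric]
      by (simp_all add: ps)
    with d f show "\<exists>d\<in>C. \<exists>f\<in>C. psum (Gamma G u) d a = Some s \<and> psum (Gamma G u) b f = Some s"
      by blast
  next
    fix a assume a: "a \<in> C" and "psum (Gamma G u) u a \<noteq> None \<or> psum (Gamma G u) a u \<noteq> None"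
    note [simp] = CG(1)[OF a] uG
    consider "u \<otimes> a \<preceq> u" | "a \<otimes> u \<preceq> u"
      using \<open>_ \<or> _\<close> by (auto simp: ps C_def split: if_splits)
    then have "a \<preceq> \<one>"
    proof cases
      case 1
      then show ?thesis
        using po_mult_left[of "u \<otimes> a" u "inv u"] by (simp add: m_assoc[symmetric])
    next
      case 2
      then show ?thesis
        using po_mult_right[of "a \<otimes> u" u "inv u"] by (simp add: m_assoc)
    qed
    then show "a = \<one>" using CG[OF a] po_antisym by auto
  qed
qed


section \<open>Kites\<close>

text \<open>Families indexed by \<open>I\<close> are extensional functions on \<open>I\<close>. The lower part is the \<open>Inl\<close>
  summand and the upper part the \<open>Inr\<close> summand; an upper element \<open>Inr x\<close> is stored as the family
  \<open>x\<close> of elements of the negative cone, so that the elements \<open>a\<^sub>i\<close> with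
  \<open>x\<^sub>i = a\<^sub>i\<inverse>\<close> are recovered as \<open>inv x i\<close>.\<close>

fun kite_sum ::
  "('a, 'm) po_monoid_scheme \<Rightarrow> 'i set \<Rightarrow> ('i \<Rightarrow> 'i) \<Rightarrow> ('i \<Rightarrow> 'i) \<Rightarrow>
   ('i \<Rightarrow> 'a) + ('i \<Rightarrow> 'a) \<Rightarrow> ('i \<Rightarrow> 'a) + ('i \<Rightarrow> 'a) \<Rightarrow> (('i \<Rightarrow> 'a) + ('i \<Rightarrow> 'a)) option" where
  "kite_sum G I l r (Inr x) (Inr y) = None"
| "kite_sum G I l r (Inr x) (Inl f) =
    (if \<forall>i\<in>I. f (inv_into I r i) \<preceq>\<^bsub>G\<^esub> inv\<^bsub>G\<^esub> (x i)
     then Some (Inr (\<lambda>i\<in>I. x i \<otimes>\<^bsub>G\<^esub> f (inv_into I r i))) else None)"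
| "kite_sum G I l r (Inl f) (Inr x) =
    (if \<forall>i\<in>I. f (inv_into I l i) \<preceq>\<^bsub>G\<^esub> inv\<^bsub>G\<^esub> (x i)
     then Some (Inr (\<lambda>i\<in>I. f (inv_into I l i) \<otimes>\<^bsub>G\<^esub> x i)) else None)"
| "kite_sum G I l r (Inl f) (Inl g) = Some (Inl (\<lambda>i\<in>I. f i \<otimes>\<^bsub>G\<^esub> g i))"

definition kite ::
  "('a, 'm) po_monoid_scheme \<Rightarrow> 'i set \<Rightarrow> ('i \<Rightarrow> 'i) \<Rightarrow> ('i \<Rightarrow> 'i) \<Rightarrow>
   (('i \<Rightarrow> 'a) + ('i \<Rightarrow> 'a)) partial_algebra" where
  "kite G I l r =
    \<lparr>carrier = (I \<rightarrow>\<^sub>E pos_cone G) <+> (I \<rightarrow>\<^sub>E neg_cone G),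
     psum = kite_sum G I l r,
     pzero = Inl (\<lambda>i\<in>I. \<one>\<^bsub>G\<^esub>),
     punit = Inr (\<lambda>i\<in>I. \<one>\<^bsub>G\<^esub>)\<rparr>"


section \<open>The lexicographic semidirect product of the integers with a power of a po-group\<close>

text \<open>The integer power of \<open>\<phi>\<close> is taken in the group of bijections of \<open>I\<close>, so \<open>\<phi>\<close> should
  be in \<open>Bij I\<close>, i.e. be a bijection of \<open>I\<close> that is normalized to \<open>undefined\<close> outside \<open>I\<close>.\<close>

definition semidirect_Z ::
  "('i \<Rightarrow> 'i) \<Rightarrow> 'i set \<Rightarrow> ('a, 'm) po_monoid_scheme \<Rightarrow> (int \<times> ('i \<Rightarrow> 'a)) po_monoid" where
  "semidirect_Z \<phi> I G =
    \<lparr>carrier = UNIV \<times> (I \<rightarrow>\<^sub>E carrier G),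
     mult = (\<lambda>(n, x) (m, y). (n + m, \<lambda>i\<in>I. x i \<otimes>\<^bsub>G\<^esub> y ((\<phi> [^]\<^bsub>BijGroup I\<^esub> n) i))),
     one = (0, \<lambda>i\<in>I. \<one>\<^bsub>G\<^esub>),
     po_le = (\<lambda>(n, x) (m, y). n < m \<or> n = m \<and> (\<forall>i\<in>I. x i \<preceq>\<^bsub>G\<^esub> y i))\<rparr>"

lemma
  assumes "\<phi> \<in> Bij I"
  shows Bij_int_pow_mem: "i \<in> I \<Longrightarrow> (\<phi> [^]\<^bsub>BijGroup I\<^esub> (n::int)) i \<in> I"
    and Bij_int_pow_0: "i \<in> I \<Longrightarrow> (\<phi> [^]\<^bsub>BijGroup I\<^esub> (0::int)) i = i"
    and Bij_int_pow_1: "\<phi> [^]\<^bsub>BijGroup I\<^esub> (1::int) = \<phi>"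
    and Bij_int_pow_add: "i \<in> I \<Longrightarrow> (\<phi> [^]\<^bsub>BijGroup I\<^esub> (n + m)) i =
          (\<phi> [^]\<^bsub>BijGroup I\<^esub> (n::int)) ((\<phi> [^]\<^bsub>BijGroup I\<^esub> m) i)"
proof -
  interpret B: group "BijGroup I" by (rule group_BijGroup)
  have car: "carrier (BijGroup I) = Bij I"
    and mult: "\<And>f g. f \<in> Bij I \<Longrightarrow> g \<in> Bij I \<Longrightarrow> f \<otimes>\<^bsub>BijGroup I\<^esub> g = compose I f g"
    and one: "\<one>\<^bsub>BijGroup I\<^esub> = (\<lambda>i\<in>I. i)"
    by (simp_all add: BijGroup_def)
  have \<phi>: "\<phi> \<in> carrier (BijGroup I)" using assms by (simp only: car)
  have pow: "\<phi> [^]\<^bsub>BijGroup I\<^esub> k \<in> Bij I" for k :: int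
    using B.int_pow_closed[OF \<phi>, of k] by (simp only: car)
  show "i \<in> I \<Longrightarrow> (\<phi> [^]\<^bsub>BijGroup I\<^esub> (n::int)) i \<in> I"
    using Bij_imp_funcset[OF pow] by blast
  show "i \<in> I \<Longrightarrow> (\<phi> [^]\<^bsub>BijGroup I\<^esub> (0::int)) i = i"
    by (simp add: one)
  show "\<phi> [^]\<^bsub>BijGroup I\<^esub> (1::int) = \<phi>"
    by (rule B.int_pow_1[OF \<phi>])
  show "(\<phi> [^]\<^bsub>BijGroup I\<^esub> (n + m)) i =
      (\<phi> [^]\<^bsub>BijGroup I\<^esub> (n::int)) ((\<phi> [^]\<^bsub>BijGroup I\<^esub> m) i)" if "i \<in> I"
    unfolding B.int_pow_mult[OF \<phi>] mult[OF pow pow] compose_def using that by simp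
qed

lemma (in po_group) po_group_semidirect_Z:
  assumes \<phi>: "\<phi> \<in> Bij I"
  shows "po_group (semidirect_Z \<phi> I G)" (is "po_group ?H")
proof -
  note P = Bij_int_pow_mem[OF \<phi>] Bij_int_pow_0[OF \<phi>] Bij_int_pow_add[OF \<phi>]
  have car: "carrier ?H = UNIV \<times> (I \<rightarrow>\<^sub>E carrier G)"
    and mul: "(n, x) \<otimes>\<^bsub>?H\<^esub> (m, y) = (n + m, \<lambda>i\<in>I. x i \<otimes> y ((\<phi> [^]\<^bsub>BijGroup I\<^esub> n) i))"
    and one: "\<one>\<^bsub>?H\<^esub> = (0, \<lambda>i\<in>I. \<one>)"
    and le: "(n, x) \<preceq>\<^bsub>?H\<^esub> (m, y) \<longleftrightarrow> n < m \<or> n = m \<and> (\<forall>i\<in>I. x i \<preceq> y i)" for n m x y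
    by (auto simp: semidirect_Z_def)
  have ext: "x = y" if "x \<in> I \<rightarrow>\<^sub>E carrier G" "y \<in> I \<rightarrow>\<^sub>E carrier G" "\<And>i. i \<in> I \<Longrightarrow> x i = y i"
    for x y using that by (rule PiE_ext)
  have mem: "x i \<in> carrier G" if "x \<in> I \<rightarrow>\<^sub>E carrier G" "i \<in> I" for x i
    using that by auto
  have "group ?H"
  proof (rule groupI)
    show "p \<otimes>\<^bsub>?H\<^esub> q \<in> carrier ?H" if "p \<in> carrier ?H" "q \<in> carrier ?H" for p q
      using that by (cases p; cases q) (auto simp: car mul P intro!: m_closed intro: mem)
    show "\<one>\<^bsub>?H\<^esub> \<in> carrier ?H" by (auto simp: one car)
    show "p \<otimes>\<^bsub>?H\<^esub> q \<otimes>\<^bsub>?H\<^esub> r = p \<otimes>\<^bsub>?H\<^esub> (q \<otimes>\<^bsub>?H\<^esub> r)"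
      if "p \<in> carrier ?H" "q \<in> carrier ?H" "r \<in> carrier ?H" for p q r
    proof (cases p; cases q; cases r)
      fix n x m y k z assume [simp]: "p = (n, x)" "q = (m, y)" "r = (k, z)"
      have "(\<lambda>i\<in>I. x i \<otimes> y ((\<phi> [^]\<^bsub>BijGroup I\<^esub> n) i) \<otimes> z ((\<phi> [^]\<^bsub>BijGroup I\<^esub> (n + m)) i)) =
            (\<lambda>i\<in>I. x i \<otimes> (y ((\<phi> [^]\<^bsub>BijGroup I\<^esub> n) i) \<otimes>
                z ((\<phi> [^]\<^bsub>BijGroup I\<^esub> m) ((\<phi> [^]\<^bsub>BijGroup I\<^esub> n) i))))"
      proof (rule restrict_ext)
        fix i assume i: "i \<in> I"
        show "x i \<otimes> y ((\<phi> [^]\<^bsub>BijGroup I\<^esub> n) i) \<otimes> z ((\<phi> [^]\<^bsub>BijGroup I\<^esub> (n + m)) i) =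
            x i \<otimes> (y ((\<phi> [^]\<^bsub>BijGroup I\<^esub> n) i) \<otimes>
                z ((\<phi> [^]\<^bsub>BijGroup I\<^esub> m) ((\<phi> [^]\<^bsub>BijGroup I\<^esub> n) i)))"
          unfolding add.commute[of n m] P(3)[OF i]
          using that i by (intro m_assoc) (auto simp: car P intro: mem)
      qed
      then show ?thesis
        by (auto simp: mul P add.assoc cong: restrict_cong)
    qed
    show "\<one>\<^bsub>?H\<^esub> \<otimes>\<^bsub>?H\<^esub> p = p" if "p \<in> carrier ?H" for p
    proof (cases p)
      case [simp]: (Pair n x)
      have "(\<lambda>i\<in>I. \<one> \<otimes> x i) = x" using that by (intro ext) (auto simp: car mem)
      then show ?thesis by (simp add: one mul P del: int_pow_0 cong: restrict_cong)
    qed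
    show "\<exists>q\<in>carrier ?H. q \<otimes>\<^bsub>?H\<^esub> p = \<one>\<^bsub>?H\<^esub>" if "p \<in> carrier ?H" for p
    proof (cases p)
      case [simp]: (Pair n x)
      have x: "x \<in> I \<rightarrow>\<^sub>E carrier G" using that by (simp add: car)
      let ?q = "(- n, \<lambda>i\<in>I. inv (x ((\<phi> [^]\<^bsub>BijGroup I\<^esub> (- n)) i)))"
      have "?q \<in> carrier ?H" using x by (auto simp: car P intro!: inv_closed intro: mem)
      moreover have "?q \<otimes>\<^bsub>?H\<^esub> p = \<one>\<^bsub>?H\<^esub>"
        using x by (auto simp: mul one P mem intro!: restrict_ext l_inv)
      ultimately show ?thesis by blast
    qed
  qed
  then show ?thesis
  proof (intro po_group.intro po_group_axioms.intro)
    fix p q r assume pqr: "p \<in> carrier ?H" "q \<in> carrier ?H" "r \<in> carrier ?H"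
    obtain n x m y k z where eq: "p = (n, x)" "q = (m, y)" "r = (k, z)"
      by (cases p; cases q; cases r)
    have x: "x \<in> I \<rightarrow>\<^sub>E carrier G" and y: "y \<in> I \<rightarrow>\<^sub>E carrier G" and z: "z \<in> I \<rightarrow>\<^sub>E carrier G"
      using pqr by (simp_all add: eq car)
    note m = mem[OF x] mem[OF y] mem[OF z]
    show "p \<preceq>\<^bsub>?H\<^esub> p"
      by (simp add: eq le po_refl m)
    show "p = q" if "p \<preceq>\<^bsub>?H\<^esub> q" "q \<preceq>\<^bsub>?H\<^esub> p"
    proof -
      have "n = m" and i: "\<forall>i\<in>I. x i \<preceq> y i" "\<forall>i\<in>I. y i \<preceq> x i"
        using that by (auto simp: eq le)
      moreover have "x = y" using i m by (intro ext[OF x y] po_antisym) simp_all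
      ultimately show ?thesis by (simp add: eq)
    qed
    show "p \<preceq>\<^bsub>?H\<^esub> r" if "p \<preceq>\<^bsub>?H\<^esub> q" "q \<preceq>\<^bsub>?H\<^esub> r"
    proof -
      have "x i \<preceq> z i" if "i \<in> I" "\<forall>i\<in>I. x i \<preceq> y i" "\<forall>i\<in>I. y i \<preceq> z i" for i
        using that m po_trans[of "x i" "y i" "z i"] by simp
      then show ?thesis using that by (auto simp: eq le)
    qed
    show "r \<otimes>\<^bsub>?H\<^esub> p \<preceq>\<^bsub>?H\<^esub> r \<otimes>\<^bsub>?H\<^esub> q" if "p \<preceq>\<^bsub>?H\<^esub> q"
      using that m P(1) by (auto simp: eq le mul intro: po_mult_left)
    show "p \<otimes>\<^bsub>?H\<^esub> r \<preceq>\<^bsub>?H\<^esub> q \<otimes>\<^bsub>?H\<^esub> r" if "p \<preceq>\<^bsub>?H\<^esub> q"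
      using that m P(1) by (auto simp: eq le mul intro: po_mult_right)
  qed
qed

lemma unit_in_pos_cone: "(1, \<lambda>i\<in>I. \<one>\<^bsub>G\<^esub>) \<in> pos_cone (semidirect_Z \<phi> I G)"
  if "po_group G"
proof -
  interpret po_group G by fact
  show ?thesis by (auto simp: pos_cone_def semidirect_Z_def)
qed

end

(* With phi = l o r^-1, the map sending a lower element f to (0, f o l^-1) and an upper element x
   to (1, x) turns both mixed kite sums into products of the semidirect product.  The kite axioms
   are not verified directly but pulled back from the interval algebra. *)
theory Submission
  imports Defs
begin

text \<open>The \<open>map_option\<close> equation makes \<open>h\<close> preserve and reflect
  definedness of sums, so every axiom of \<open>F\<close> can be read back in \<open>E\<close>; that
  \<open>E\<close> is a pseudo effect algebra is a conclusion here. Preservation of zero is what the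
  axiom on sums with the unit needs.\<close>

lemma pea_isomorphic_if_psum_eq:
  assumes F: "pseudo_effect_algebra F"
    and bij: "bij_betw h (carrier E) (carrier F)"
    and closed: "\<And>a b s. \<lbrakk>a \<in> carrier E; b \<in> carrier E; psum E a b = Some s\<rbrakk> \<Longrightarrow> s \<in> carrier E"
    and psum: "\<And>a b. \<lbrakk>a \<in> carrier E; b \<in> carrier E\<rbrakk> \<Longrightarrow>
      psum F (h a) (h b) = map_option h (psum E a b)"
    and zero: "pzero E \<in> carrier E" "h (pzero E) = pzero F"
    and unit: "punit E \<in> carrier E" "h (punit E) = punit F"
  shows "pea_isomorphic E F"
proof -
  interpret F: pseudo_effect_algebra F by (fact F)
  have hC: "h a \<in> carrier F" if "a \<in> carrier E" for a
    using bij that by (auto simp: bij_betw_def)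
  have inj: "h a = h b \<longleftrightarrow> a = b" if "a \<in> carrier E" "b \<in> carrier E" for a b
    using bij that by (auto simp: bij_betw_def inj_on_eq_iff)
  have surj: "\<exists>a\<in>carrier E. y = h a" if "y \<in> carrier F" for y
    using bij that by (auto simp: bij_betw_def)
  \<comment> \<open>Closure puts the sum in \<open>carrier E\<close>, the only place where
    \<open>h\<close> is known to be injective.\<close>
  have some_iff: "psum F (h a) (h b) = Some (h s) \<longleftrightarrow> psum E a b = Some s"
    if "a \<in> carrier E" "b \<in> carrier E" "s \<in> carrier E" for a b s
    using psum[OF that(1,2)] closed[OF that(1,2)] that(3) by (cases "psum E a b") (auto simp: inj)
  \<comment> \<open>Transport of unique existence back along the bijection, serving both complement
    axioms.\<close>
  have pull_ex1: "\<exists>!d. d \<in> carrier E \<and> Q d"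
    if ex1: "\<exists>!y. y \<in> carrier F \<and> P y" and iff: "\<And>d. d \<in> carrier E \<Longrightarrow> P (h d) \<longleftrightarrow> Q d" for P Q
  proof -
    obtain y where "y \<in> carrier F" "P y" using ex1 by blast
    then obtain d where d: "d \<in> carrier E" "P (h d)" using surj[of y] by auto
    have uniq: "y = z" if "y \<in> carrier F" "P y" "z \<in> carrier F" "P z" for y z
      using ex1 that by blast
    have unique: "e = d" if e: "e \<in> carrier E" "Q e" for e
    proof -
      have "h e = h d"
        by (rule uniq) (simp_all add: hC e d iff)
      then show ?thesis by (simp add: inj[OF e(1) d(1)])
    qed
    show ?thesis
    proof (rule ex1I)
      show "d \<in> carrier E \<and> Q d" using d iff by simp
    qed (elim conjE, rule unique)
  qed
  have "pseudo_effect_algebra E"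
  proof
    fix a b c assume C: "a \<in> carrier E" "b \<in> carrier E" "c \<in> carrier E"
    have ab: "s \<in> carrier E" if "psum E a b = Some s" for s
      using closed[OF C(1,2) that] .
    have bc: "t \<in> carrier E" if "psum E b c = Some t" for t
      using closed[OF C(2,3) that] .
    \<comment> \<open>Associativity is first shown after applying \<open>h\<close>, where it is
      associativity in \<open>F\<close>, and \<open>h\<close> is then cancelled.\<close>
    have "map_option h (Option.bind (psum E a b) (\<lambda>s. psum E s c))
        = Option.bind (psum F (h a) (h b)) (\<lambda>s. psum F s (h c))"
      using psum[OF C(1,2)] psum[OF ab C(3)] by (cases "psum E a b") simp_all
    also have "\<dots> = Option.bind (psum F (h b) (h c)) (\<lambda>t. psum F (h a) t)"
      by (rule F.psum_assoc[OF hC[OF C(1)] hC[OF C(2)] hC[OF C(3)]])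
    also have "\<dots> = map_option h (Option.bind (psum E b c) (\<lambda>t. psum E a t))"
      using psum[OF C(2,3)] psum[OF C(1) bc] by (cases "psum E b c") simp_all
    finally have eq: "map_option h (Option.bind (psum E a b) (\<lambda>s. psum E s c))
        = map_option h (Option.bind (psum E b c) (\<lambda>t. psum E a t))" .
    show "Option.bind (psum E a b) (\<lambda>s. psum E s c) = Option.bind (psum E b c) (\<lambda>t. psum E a t)"
    \<comment> \<open>The strong form asks for injectivity only on values that occur, and these lie
      in the carrier by closure.\<close>
    proof (rule option.inj_map_strong[OF _ eq])
      fix s t
      assume "s \<in> set_option (Option.bind (psum E a b) (\<lambda>s. psum E s c))"
        and "t \<in> set_option (Option.bind (psum E b c) (\<lambda>t. psum E a t))" and "h s = h t"
      moreover from this have "s \<in> carrier E" "t \<in> carrier E"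
        using closed[OF ab C(3)] closed[OF C(1) bc] by (auto simp: bind_eq_Some_conv)
      ultimately show "s = t"
        using inj by simp
    qed
  next
    fix a assume a: "a \<in> carrier E"
    show "\<exists>!d. d \<in> carrier E \<and> psum E a d = Some (punit E)"
      using F.right_complement[OF hC[OF a]]
      by (rule pull_ex1) (use a unit some_iff[OF _ _ unit(1)] in simp)
    show "\<exists>!d. d \<in> carrier E \<and> psum E d a = Some (punit E)"
      using F.left_complement[OF hC[OF a]]
      by (rule pull_ex1) (use a unit some_iff[OF _ _ unit(1)] in simp)
    show "a = pzero E" if "psum E (punit E) a \<noteq> None \<or> psum E a (punit E) \<noteq> None"
    proof -
      have "psum F (punit F) (h a) \<noteq> None \<or> psum F (h a) (punit F) \<noteq> None"
        using that psum[OF unit(1) a] psum[OF a unit(1)] by (auto simp: unit)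
      then show ?thesis
        using F.psum_punit[OF hC[OF a]] inj[OF a zero(1)] zero(2) by simp
    qed
  next
    fix a b s assume C: "a \<in> carrier E" "b \<in> carrier E" and s: "psum E a b = Some s"
    have sE: "s \<in> carrier E" using closed[OF C s] .
    have "psum F (h a) (h b) = Some (h s)" using some_iff C sE s by simp
    from F.psum_conjugate[OF hC[OF C(1)] hC[OF C(2)] this]
    show "\<exists>d\<in>carrier E. \<exists>f\<in>carrier E. psum E d a = Some s \<and> psum E b f = Some s"
      using surj some_iff C sE by metis
  qed (fact closed zero unit)+
  moreover have "h \<in> pea_hom E F"
    using hC psum unit by (auto simp: pea_hom_def)
  moreover have "inv_into (carrier E) h \<in> pea_hom F E"
  proof -
    let ?g = "inv_into (carrier E) h"
    have gC: "?g y \<in> carrier E" and hg: "h (?g y) = y" if "y \<in> carrier F" for y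
      using bij that by (auto simp: bij_betw_def inv_into_into f_inv_into_f)
    \<comment> \<open>This is \<open>some_iff\<close> at the preimages, using that \<open>h\<close>
      reflects sums.\<close>
    have "psum E (?g a) (?g b) = Some (?g s)"
      if "a \<in> carrier F" "b \<in> carrier F" "psum F a b = Some s" for a b s
      using that F.psum_closed[OF that] some_iff[of "?g a" "?g b" "?g s"] by (simp add: gC hg)
    moreover have "?g (punit F) = punit E"
      using bij unit by (metis bij_betw_inv_into_left)
    ultimately show ?thesis using gC by (auto simp: pea_hom_def)
  qed
  ultimately show ?thesis
    using F bij by (auto simp: pea_isomorphic_def pea_iso_def)
qed

context po_group
begin

text \<open>Multiply on the left by \<open>inv x\<close>, and back by \<open>x\<close>. Since the
  group may be non-Abelian, upper + lower and lower + upper each need their own version to turn the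
  kite's definedness condition into membership in the negative cone.\<close>

lemma mult_le_one_iff_le_inv_right:
  assumes "x \<in> carrier G" "y \<in> carrier G"
  shows "x \<otimes> y \<preceq> \<one> \<longleftrightarrow> y \<preceq> inv x"
  using assms po_mult_left[of "x \<otimes> y" \<one> "inv x"] po_mult_left[of y "inv x" x]
  by (auto simp: m_assoc[symmetric])

lemma mult_le_one_iff_le_inv_left:
  assumes "x \<in> carrier G" "y \<in> carrier G"
  shows "x \<otimes> y \<preceq> \<one> \<longleftrightarrow> x \<preceq> inv y"
  using assms po_mult_right[of "x \<otimes> y" \<one> "inv y"] po_mult_right[of x "inv y" y]
  by (auto simp: m_assoc)

lemma pos_cone_mult_closed:
  assumes "x \<in> pos_cone G" "y \<in> pos_cone G"
  shows "x \<otimes> y \<in> pos_cone G"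
  using assms po_mult_left[of \<one> y x] po_trans[of \<one> x "x \<otimes> y"] by (auto simp: pos_cone_def)

text \<open>In a mixed sum the definedness condition says exactly that every product is below the
  identity; bijectivity keeps the shifted indices in \<open>I\<close>.\<close>

lemma kite_psum_closed:
  assumes l: "bij_betw l I I" and r: "bij_betw r I I"
    and "a \<in> carrier (kite G I l r)" "b \<in> carrier (kite G I l r)"
    and "psum (kite G I l r) a b = Some s"
  shows "s \<in> carrier (kite G I l r)"
proof -
  have inv_mem: "inv_into I l i \<in> I" "inv_into I r i \<in> I" if "i \<in> I" for i
    using that l r by (auto simp: bij_betw_def inv_into_into)
  have pos: "f i \<in> carrier G" if "f \<in> I \<rightarrow>\<^sub>E pos_cone G" "i \<in> I" for f i
    using that by (auto simp: pos_cone_def)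
  \<comment> \<open>Stated with the negative cone unfolded because the final call unfolds it, while
    the positive cone stays folded for \<open>pos_cone_mult_closed\<close>.\<close>
  have neg: "f i \<in> carrier G" if "f \<in> I \<rightarrow>\<^sub>E {g \<in> carrier G. g \<preceq> \<one>}" "i \<in> I" for f i
    using that by auto
  have mult_le_one: "x \<otimes> y \<preceq> \<one>" if "y \<preceq> inv x \<or> x \<preceq> inv y" "x \<in> carrier G" "y \<in> carrier G" for x y
    using that mult_le_one_iff_le_inv_left[of x y] mult_le_one_iff_le_inv_right[of x y] by auto
  show ?thesis
    using assms(3-5)
    by (cases a; cases b)
      (auto simp: kite_def neg_cone_def[of G] inv_mem pos neg split: if_splits
         intro!: pos_cone_mult_closed mult_le_one)
qed

text \<open>The lexicographic order leaves only the levels 0 and 1. At level 0 the upper bound is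
  automatic, at level 1 the lower bound, so the two kite parts appear.\<close>

lemma carrier_Gamma_semidirect_Z:
  "carrier (Gamma (semidirect_Z \<phi> I G) (1, \<lambda>i\<in>I. \<one>)) =
     {0} \<times> (I \<rightarrow>\<^sub>E pos_cone G) \<union> {1} \<times> (I \<rightarrow>\<^sub>E neg_cone G)"
  by (auto simp: Gamma_def semidirect_Z_def pos_cone_def neg_cone_def PiE_iff)

text \<open>The choice of \<open>\<phi>\<close> is forced by upper + lower: the product reads the
  reindexed \<open>f\<close> at \<open>\<phi> i\<close>, the kite reads \<open>f\<close> at
  \<open>inv_into I r i\<close>, so \<open>inv_into I l (\<phi> i)\<close> must equal
  \<open>inv_into I r i\<close>. Restricting to \<open>I\<close> gives the normalization that
  \<open>Bij I\<close> demands.\<close>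

lemma pea_isomorphic_kite:
  assumes l: "bij_betw l I I" and r: "bij_betw r I I"
  defines "\<phi> \<equiv> \<lambda>i\<in>I. l (inv_into I r i)"
  shows "\<phi> \<in> Bij I"
    and "pea_isomorphic (kite G I l r) (Gamma (semidirect_Z \<phi> I G) (1, \<lambda>i\<in>I. \<one>))"
      (is "pea_isomorphic ?K ?\<Gamma>")
proof -
  have l': "bij_betw (inv_into I l) I I" and r': "bij_betw (inv_into I r) I I"
    using l r by (auto intro: bij_betw_inv_into)
  have inv_mem: "inv_into I l i \<in> I" "inv_into I r i \<in> I" "l i \<in> I" if "i \<in> I" for i
    using that l l' r' by (auto simp: bij_betw_def)
  have inv_l: "inv_into I l (l i) = i" "l (inv_into I l i) = i" if "i \<in> I" for i
    using that l by (auto simp: bij_betw_inv_into_left bij_betw_inv_into_right)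
  have "bij_betw \<phi> I I"
    using bij_betw_trans[OF r' l] by (simp add: \<phi>_def comp_def cong: bij_betw_cong)
  then show \<phi>: "\<phi> \<in> Bij I"
    by (simp add: Bij_def \<phi>_def)
  have PiE_pos: "f i \<in> carrier G" if "f \<in> I \<rightarrow>\<^sub>E pos_cone G" "i \<in> I" for f i
    using that by (auto simp: pos_cone_def)
  have PiE_neg: "f i \<in> carrier G" if "f \<in> I \<rightarrow>\<^sub>E neg_cone G" "i \<in> I" for f i
    using that by (auto simp: neg_cone_def)
  \<comment> \<open>A left factor of level 0 does not shift the right one, so the
    \<open>l\<close>-shift of lower + upper has to be built into \<open>h\<close>.\<close>
  define h :: "('b \<Rightarrow> 'a) + ('b \<Rightarrow> 'a) \<Rightarrow> int \<times> ('b \<Rightarrow> 'a)" where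
    "h = case_sum (\<lambda>f. (0, \<lambda>i\<in>I. f (inv_into I l i))) (\<lambda>x. (1, x))"
  have K: "carrier ?K = (I \<rightarrow>\<^sub>E pos_cone G) <+> (I \<rightarrow>\<^sub>E neg_cone G)"
    "psum ?K = kite_sum G I l r" "pzero ?K = Inl (\<lambda>i\<in>I. \<one>)" "punit ?K = Inr (\<lambda>i\<in>I. \<one>)"
    by (simp_all add: kite_def)
  \<comment> \<open>The inverse of \<open>h\<close>: reindexing by \<open>l\<close> undoes the
    shift. Families are extensional, so the restrictions are harmless
    (\<open>restr\<close>).\<close>
  define g :: "int \<times> ('b \<Rightarrow> 'a) \<Rightarrow> ('b \<Rightarrow> 'a) + ('b \<Rightarrow> 'a)" where
    "g = (\<lambda>(n, x). if n = 0 then Inl (\<lambda>i\<in>I. x (l i)) else Inr x)"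
  have restr: "(\<lambda>i\<in>I. x i) = x" if "x \<in> I \<rightarrow>\<^sub>E A" for x A
    using that by (auto simp: PiE_def extensional_restrict)
  have bij: "bij_betw h (carrier ?K) (carrier ?\<Gamma>)"
  proof (rule bij_betw_byWitness[where f' = g])
    show "\<forall>p\<in>carrier ?K. g (h p) = p"
      by (auto simp: K h_def g_def inv_mem inv_l restr cong: restrict_cong)
    show "\<forall>q\<in>carrier ?\<Gamma>. h (g q) = q"
      by (auto simp: carrier_Gamma_semidirect_Z h_def g_def inv_mem inv_l restr cong: restrict_cong)
    show "h ` carrier ?K \<subseteq> carrier ?\<Gamma>"
      by (auto simp: carrier_Gamma_semidirect_Z K h_def inv_mem)
    show "g ` carrier ?\<Gamma> \<subseteq> carrier ?K"
      using inv_mem(3) by (auto simp: carrier_Gamma_semidirect_Z K g_def PiE_iff intro: extensional_arb)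
  qed
  note pow = Bij_int_pow_0[OF \<phi>] Bij_int_pow_1[OF \<phi>]
  have mult: "p \<otimes>\<^bsub>semidirect_Z \<phi> I G\<^esub> q =
      (fst p + fst q, \<lambda>i\<in>I. snd p i \<otimes> snd q ((\<phi> [^]\<^bsub>BijGroup I\<^esub> fst p) i))" for p q
    by (simp add: semidirect_Z_def case_prod_beta)
  have psum_\<Gamma>: "psum ?\<Gamma> p q = (if p \<otimes>\<^bsub>semidirect_Z \<phi> I G\<^esub> q \<in> carrier ?\<Gamma>
      then Some (p \<otimes>\<^bsub>semidirect_Z \<phi> I G\<^esub> q) else None)" for p q
    by (simp add: Gamma_def)
  have psum: "psum ?\<Gamma> (h a) (h b) = map_option h (psum ?K a b)"
    if a: "a \<in> carrier ?K" and b: "b \<in> carrier ?K" for a b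
  proof (cases a; cases b)
    fix f g assume [simp]: "a = Inl f" "b = Inl g"
    have fg: "f \<in> I \<rightarrow>\<^sub>E pos_cone G" "g \<in> I \<rightarrow>\<^sub>E pos_cone G" using a b by (auto simp: K)
    have "h a \<otimes>\<^bsub>semidirect_Z \<phi> I G\<^esub> h b =
        (0, \<lambda>i\<in>I. f (inv_into I l i) \<otimes> g (inv_into I l i))"
      \<comment> \<open>\<open>int_pow_0\<close> would rewrite the zeroth power to the identity of
        \<open>BijGroup I\<close> before \<open>pow\<close> can evaluate it pointwise.\<close>
      by (simp add: mult h_def pow inv_mem del: int_pow_0 cong: restrict_cong)
    moreover have "\<dots> \<in> carrier ?\<Gamma>"
      using fg by (auto simp: carrier_Gamma_semidirect_Z inv_mem intro!: pos_cone_mult_closed)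
    ultimately show ?thesis
      by (simp add: psum_\<Gamma> K) (simp add: h_def inv_mem cong: restrict_cong)
  next
    fix f x assume [simp]: "a = Inl f" "b = Inr x"
    have fx: "f \<in> I \<rightarrow>\<^sub>E pos_cone G" "x \<in> I \<rightarrow>\<^sub>E neg_cone G" using a b by (auto simp: K)
    have "h a \<otimes>\<^bsub>semidirect_Z \<phi> I G\<^esub> h b = (1, \<lambda>i\<in>I. f (inv_into I l i) \<otimes> x i)"
      by (simp add: mult h_def pow del: int_pow_0 cong: restrict_cong)
    \<comment> \<open>At level 1 membership means that all products lie in the negative cone, so the
      undefined sums correspond as well.\<close>
    moreover have "(1, \<lambda>i\<in>I. f (inv_into I l i) \<otimes> x i) \<in> carrier ?\<Gamma> \<longleftrightarrow>
        (\<forall>i\<in>I. f (inv_into I l i) \<preceq> inv (x i))"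
      using PiE_pos[OF fx(1)] PiE_neg[OF fx(2)]
      by (auto simp: carrier_Gamma_semidirect_Z Pi_iff neg_cone_def inv_mem
          mult_le_one_iff_le_inv_left)
    ultimately show ?thesis
      by (simp add: psum_\<Gamma> K) (simp add: h_def)
  next
    fix x f assume [simp]: "a = Inr x" "b = Inl f"
    have fx: "f \<in> I \<rightarrow>\<^sub>E pos_cone G" "x \<in> I \<rightarrow>\<^sub>E neg_cone G" using a b by (auto simp: K)
    \<comment> \<open>The left factor has level 1, so \<open>\<phi>\<close> itself acts on the right
      one, and the \<open>l\<close> in it cancels the shift made by \<open>h\<close>, leaving the
      inverse of \<open>r\<close>.\<close>
    have "h a \<otimes>\<^bsub>semidirect_Z \<phi> I G\<^esub> h b = (1, \<lambda>i\<in>I. x i \<otimes> f (inv_into I r i))"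
      by (simp add: mult h_def pow)
        (simp add: \<phi>_def inv_mem inv_l cong: restrict_cong)
    moreover have "(1, \<lambda>i\<in>I. x i \<otimes> f (inv_into I r i)) \<in> carrier ?\<Gamma> \<longleftrightarrow>
        (\<forall>i\<in>I. f (inv_into I r i) \<preceq> inv (x i))"
      using PiE_pos[OF fx(1)] PiE_neg[OF fx(2)]
      by (auto simp: carrier_Gamma_semidirect_Z Pi_iff neg_cone_def inv_mem
          mult_le_one_iff_le_inv_right)
    ultimately show ?thesis
      by (simp add: psum_\<Gamma> K) (simp add: h_def)
  next
    fix x y assume [simp]: "a = Inr x" "b = Inr y"
    \<comment> \<open>The product has level 2, outside the interval, so both sides are
      undefined.\<close>
    show ?thesis by (simp add: psum_\<Gamma> K mult h_def carrier_Gamma_semidirect_Z)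
  qed
  have "pseudo_effect_algebra ?\<Gamma>"
    by (intro po_group.pseudo_effect_algebra_Gamma po_group_semidirect_Z \<phi> unit_in_pos_cone)
      (rule po_group_axioms)
  then show "pea_isomorphic ?K ?\<Gamma>"
  proof (rule pea_isomorphic_if_psum_eq[OF _ bij])
    show "s \<in> carrier ?K"
      if "a \<in> carrier ?K" "b \<in> carrier ?K" "psum ?K a b = Some s" for a b s
      using kite_psum_closed[OF l r that] .
    show "psum ?\<Gamma> (h a) (h b) = map_option h (psum ?K a b)"
      if "a \<in> carrier ?K" "b \<in> carrier ?K" for a b
      using psum[OF that] .
    show "pzero ?K \<in> carrier ?K" "punit ?K \<in> carrier ?K"
      by (auto simp: K pos_cone_def neg_cone_def po_refl)
    show "h (pzero ?K) = pzero ?\<Gamma>" "h (punit ?K) = punit ?\<Gamma>"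
      by (auto simp: K h_def Gamma_def semidirect_Z_def inv_mem cong: restrict_cong)
  qed
qed

end

theorem theorem3p2:
  fixes G :: "('a, 'm) po_monoid_scheme" and I :: "'i set" and l r :: "'i \<Rightarrow> 'i"
  assumes "po_group G"
    and "bij_betw l I I"
    and "bij_betw r I I"
  shows "\<exists>\<phi>\<in>Bij I. pea_isomorphic (kite G I l r) (Gamma (semidirect_Z \<phi> I G) (1, \<lambda>i\<in>I. \<one>\<^bsub>G\<^esub>))"
  using po_group.pea_isomorphic_kite[OF assms] by blast

end
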